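(* In contrast to the Q* Grounding language $L^{Q^*}$, which requires $O(n^2)$ function symbols for defining a term $T^*_n$ for representing the integer $n$, the Q-Grounding language $L^Q$ needs only $O(\mathrm{Log}^3\, n)$ symbols to encode a term $T_n$ representing $n$.
   Context: **Language $L^G$.** First-order language over the natural numbers with relation symbols $=,\le$, constants $C_0,C_1,C_2$ (denoting $0,1,2$), and six function symbols: integer subtraction $x-y$ (equal to $0$ if $x\le y$); integer division $x\div y$ (equal to $0$ if $y=0$ and $\lfloor x/y\rfloor$ otherwise); $\mathrm{Max}(x,y)$; $\mathrm{Root}(x,y)$ ($=\lfloor x^{1/y}\rfloor$ if $y\ge1$, and $0$ otherwise); $\mathrm{Logarithm}(x)=\lfloor\log_2 x\rfloor$; $\mathrm{Count}(x,j)=$ the number of "1" bits among $x$'s rightmost $j$ bits. Let $\mathrm{Power}(x)$ abbreviate $x=1\vee\mathrm{Logarithm}(x)\ne\mathrm{Logarithm}(x-1)$ ("$x$ is a power of 2"). **$L^Q$** (the Q-Grounding language) is $L^G$ plus a unary function symbol $\theta$, about which only the following axioms are assumed: (1) $\forall x\,(\mathrm{Power}(x)\Rightarrow\mathrm{Power}(\theta(x)))$; (2) $\forall x\;\theta(x)\ne1$; (3) $\forall x\forall y\,([x\ne y\wedge\mathrm{Power}(x)]\Rightarrow\theta(x)\ne\theta(y))$; (4) $\forall x\,(\neg\mathrm{Power}(x)\Rightarrow\theta(x)=0)$. **$L^{Q^*}$** (the Q* Grounding language) is $L^G$ plus a unary function symbol $\zeta$, about which only the following axioms are assumed: $\forall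 x\;\zeta(x)\ne0$ and $\forall x\forall y\,(x\ne y\Rightarrow\zeta(x)\ne\zeta(y))$. The terms $T^*_n$ and $T_n$ are ground terms, i.e. ordinary (tree-structured) terms built solely from function symbols and constant symbols (no variables). Such a term represents $n$ if $n$ is its unique value, i.e. its value is $n$ for every interpretation of $\theta$ (respectively $\zeta$) on the natural numbers satisfying the listed axioms, with all other symbols having their stated meaning. *)

theory Defs
  imports Complex_Main "HOL-Library.Discrete_Functions" "HOL-Library.Landau_Symbols"
begin

text \<open>
  Ground terms over the language \<open>L\<^sup>G\<close> extended by unary function symbols drawn from the
  type \<open>'u\<close>. Both \<open>L\<^sup>Q\<close> and \<open>L\<^sup>Q\<^sup>*\<close> add a single such symbol.
\<close>

datatype 'u ground_term =
    C0 | C1 | C2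
  | Minus "'u ground_term" "'u ground_term"
  | Div "'u ground_term" "'u ground_term"
  | Maximum "'u ground_term" "'u ground_term"
  | Root "'u ground_term" "'u ground_term"
  | Logarithm "'u ground_term"
  | Count "'u ground_term" "'u ground_term"
  | Ext 'u "'u ground_term"

datatype theta_symbol = Theta
datatype zeta_symbol = Zeta

type_synonym Q_term = "theta_symbol ground_term"
type_synonym Qstar_term = "zeta_symbol ground_term"

definition root_nat :: "nat \<Rightarrow> nat \<Rightarrow> nat" where
  "root_nat x y = (if y \<ge> 1 then nat \<lfloor>root y (real x)\<rfloor> else 0)"

definition count_bits :: "nat \<Rightarrow> nat \<Rightarrow> nat" where
  "count_bits x j = card {i. i < j \<and> bit x i}"

text \<open>
  On \<^typ>\<open>nat\<close>, subtraction is truncated and division by \<open>0\<close> yields \<open>0\<close>, as \<open>L\<^sup>G\<close> requires.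
  The value of \<open>Logarithm\<close> at \<open>0\<close>, where \<open>log\<^sub>2\<close> is undefined, is taken to be \<open>0\<close>
  (the convention of \<^const>\<open>floor_log\<close>); then \<open>0\<close> is not a power of \<open>2\<close> and the separate
  disjunct \<open>x = 1\<close> in the definition of \<open>Power\<close> below is needed.
\<close>

primrec eval :: "('u \<Rightarrow> nat \<Rightarrow> nat) \<Rightarrow> 'u ground_term \<Rightarrow> nat" where
  "eval I C0 = 0"
| "eval I C1 = 1"
| "eval I C2 = 2"
| "eval I (Minus s t) = eval I s - eval I t"
| "eval I (Div s t) = eval I s div eval I t"
| "eval I (Maximum s t) = max (eval I s) (eval I t)"
| "eval I (Root s t) = root_nat (eval I s) (eval I t)"
| "eval I (Logarithm t) = floor_log (eval I t)"
| "eval I (Count s t) = count_bits (eval I s) (eval I t)"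
| "eval I (Ext u t) = I u (eval I t)"

text \<open>Occurrences of function symbols, the constants \<open>C0\<close>, \<open>C1\<close>, \<open>C2\<close> not included.\<close>

primrec num_function_symbols :: "'u ground_term \<Rightarrow> nat" where
  "num_function_symbols C0 = 0"
| "num_function_symbols C1 = 0"
| "num_function_symbols C2 = 0"
| "num_function_symbols (Minus s t) = num_function_symbols s + num_function_symbols t + 1"
| "num_function_symbols (Div s t) = num_function_symbols s + num_function_symbols t + 1"
| "num_function_symbols (Maximum s t) = num_function_symbols s + num_function_symbols t + 1"
| "num_function_symbols (Root s t) = num_function_symbols s + num_function_symbols t + 1"
| "num_function_symbols (Logarithm t) = num_function_symbols t + 1"
| "num_function_symbols (Count s t) = num_function_symbols s + num_function_symbols t + 1"
| "num_function_symbols (Ext u t) = num_function_symbols t + 1"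

text \<open>Occurrences of function symbols and constants together.\<close>

primrec num_symbols :: "'u ground_term \<Rightarrow> nat" where
  "num_symbols C0 = 1"
| "num_symbols C1 = 1"
| "num_symbols C2 = 1"
| "num_symbols (Minus s t) = num_symbols s + num_symbols t + 1"
| "num_symbols (Div s t) = num_symbols s + num_symbols t + 1"
| "num_symbols (Maximum s t) = num_symbols s + num_symbols t + 1"
| "num_symbols (Root s t) = num_symbols s + num_symbols t + 1"
| "num_symbols (Logarithm t) = num_symbols t + 1"
| "num_symbols (Count s t) = num_symbols s + num_symbols t + 1"
| "num_symbols (Ext u t) = num_symbols t + 1"

definition Power :: "nat \<Rightarrow> bool" where
  "Power x \<longleftrightarrow> x = 1 \<or> floor_log x \<noteq> floor_log (x - 1)"

definition Q_axioms :: "(nat \<Rightarrow> nat) \<Rightarrow> bool" where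
  "Q_axioms \<theta> \<longleftrightarrow>
     (\<forall>x. Power x \<longrightarrow> Power (\<theta> x)) \<and>
     (\<forall>x. \<theta> x \<noteq> 1) \<and>
     (\<forall>x y. x \<noteq> y \<and> Power x \<longrightarrow> \<theta> x \<noteq> \<theta> y) \<and>
     (\<forall>x. \<not> Power x \<longrightarrow> \<theta> x = 0)"

definition Qstar_axioms :: "(nat \<Rightarrow> nat) \<Rightarrow> bool" where
  "Qstar_axioms \<zeta> \<longleftrightarrow>
     (\<forall>x. \<zeta> x \<noteq> 0) \<and>
     (\<forall>x y. x \<noteq> y \<longrightarrow> \<zeta> x \<noteq> \<zeta> y)"

definition Q_represents :: "Q_term \<Rightarrow> nat \<Rightarrow> bool" where
  "Q_represents t n \<longleftrightarrow> (\<forall>\<theta>. Q_axioms \<theta> \<longrightarrow> eval (case_theta_symbol \<theta>) t = n)"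

definition Qstar_represents :: "Qstar_term \<Rightarrow> nat \<Rightarrow> bool" where
  "Qstar_represents t n \<longleftrightarrow> (\<forall>\<zeta>. Qstar_axioms \<zeta> \<longrightarrow> eval (case_zeta_symbol \<zeta>) t = n)"

text \<open>
  The axioms are consistent, so that a term represents at most one number.
\<close>

lemma Qstar_axioms_Suc: "Qstar_axioms Suc"
  by (simp add: Qstar_axioms_def)

lemma Power_iff: "Power x \<longleftrightarrow> (\<exists>k. x = 2 ^ k)"
proof
  assume P: "Power x"
  show "\<exists>k. x = 2 ^ k"
  proof (cases "x \<le> 1")
    case True
    then have "x = 1" using P by (cases x) (auto simp: Power_def)
    then show ?thesis by (intro exI[of _ 0]) simp
  next
    case False
    define k where "k = floor_log x"
    have le: "2 ^ k \<le> x" and lt: "x < 2 * 2 ^ k"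
      using False floor_log_exp2_le[of x] floor_log_exp2_gt[of x] by (auto simp: k_def)
    have "x = 2 ^ k"
    proof (rule ccontr)
      assume "x \<noteq> 2 ^ k"
      then have "floor_log (x - 1) = k"
        using le lt by (intro floor_log_eqI) auto
      then show False using P False by (simp add: Power_def k_def)
    qed
    then show ?thesis ..
  qed
next
  assume "\<exists>k. x = 2 ^ k"
  then obtain k where k: "x = 2 ^ k" ..
  show "Power x"
  proof (cases k)
    case 0
    then show ?thesis using k by (simp add: Power_def)
  next
    case (Suc m)
    have "1 \<le> (2::nat) ^ m" by simp
    then have "x - 1 > 0" "2 ^ m \<le> x - 1" "x - 1 < 2 * 2 ^ m"
      unfolding k Suc power_Suc by linarith+
    then have "floor_log (x - 1) = m"
      by (intro floor_log_eqI)
    then show ?thesis using k Suc by (simp add: Power_def)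
  qed
qed

lemma Q_axioms_double: "Q_axioms (\<lambda>x. if Power x then 2 * x else 0)"
proof -
  have "Power (2 * x)" if "Power x" for x
    using that unfolding Power_iff by (metis power_Suc)
  moreover have "x > 0" if "Power x" for x
    using that by (auto simp: Power_iff)
  ultimately show ?thesis
    unfolding Q_axioms_def by (auto split: if_splits)
qed

end

theory Submission
  imports Defs "HOL-Real_Asymp.Real_Asymp"
begin

text \<open>
  A function that is injective on a set and misses a point of it has pairwise distinct iterates at
  that point. So, whatever the new symbol denotes, \<open>k\<close> of its iterates are \<open>k\<close> different positive
  integers in the case of \<open>\<zeta>\<close>, starting at \<open>0\<close>, and \<open>k\<close> different powers of two
  greater than \<open>1\<close> in the case of \<open>\<theta>\<close>, starting at \<open>1\<close>. Their maximum \<open>M\<close>, a term of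
  \<open>O(k\<^sup>2)\<close> symbols, is an unknown number that is at least \<open>k\<close>, respectively an unknown power of two
  that is at least \<open>2\<^sup>k\<close> (\<open>max_iterates_zeta_ge\<close>, \<open>max_iterates_theta\<close>).

  Although the value of \<open>M\<close> is unknown, it makes addition available: as long as a sum does not
  exceed \<open>M\<close>, it equals \<open>M - (M - a\<^sub>1 - \<dots> - a\<^sub>r)\<close>. Here \<open>M\<close> is written only twice, however
  many summands there are. For \<open>\<zeta>\<close>, take \<open>k = n\<close> and add up \<open>n\<close> ones. For \<open>\<theta>\<close>, take \<open>k\<close> to be
  the number of binary digits of \<open>n\<close> and add up the powers of two that occur in \<open>n\<close>. Since \<open>M\<close>
  is a power of two, \<open>2\<^sup>j\<close> is the quotient of \<open>M\<close> by the result of halving \<open>M\<close> \<open>j\<close> times, a term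
  of \<open>O(k\<^sup>2)\<close> symbols, and \<open>k\<close> such summands make \<open>O(k\<^sup>3)\<close> symbols.

  That the logarithmic bound is unattainable with \<open>\<zeta>\<close> is seen from the single interpretation
  \<open>\<zeta> = Suc\<close>: every other operation is bounded by its arguments, so the value of a
  term exceeds \<open>2\<close> by at most its number of function symbols (\<open>eval_Suc_le\<close>). Representing \<open>n\<close>
  therefore takes at least \<open>n - 2\<close> symbols.
\<close>

section \<open>Iterates of an injective function\<close>

lemma iterates_inj:
  assumes inj: "inj_on f A" and maps: "f ` A \<subseteq> A" and x: "x \<in> A" "x \<notin> f ` A"
  shows "inj (\<lambda>i. (f ^^ i) x)"
proof -
  have in_A: "(f ^^ i) x \<in> A" for i
    by (induction i) (use maps x in auto)
  have "i = j" if "(f ^^ i) x = (f ^^ j) x" for i j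
    using that
  proof (induction i arbitrary: j)
    case 0
    then show ?case using x in_A by (cases j) auto
  next
    case (Suc i)
    then show ?case
    proof (cases j)
      case 0
      then have "f ((f ^^ i) x) = x"
        using Suc.prems by simp
      then show ?thesis using x(2) in_A by (metis imageI)
    next
      case (Suc k)
      then have "(f ^^ i) x = (f ^^ k) x"
        using Suc.prems inj in_A by (auto dest: inj_onD)
      then show ?thesis using Suc.IH Suc by simp
    qed
  qed
  then show ?thesis by (auto intro: injI)
qed

lemma le_of_inj_on_into:
  fixes e :: "nat \<Rightarrow> nat"
  assumes "inj_on e {1..k}" "e ` {1..k} \<subseteq> {1..N}"
  shows "k \<le> N"
  using card_inj_on_le[OF assms] by simp

section \<open>Term constructions\<close>

text \<open>The iterates start with \<open>u t\<close>, not with \<open>t\<close>: the starting points \<open>0\<close> for \<open>\<zeta>\<close> and \<open>1 = 2\<^sup>0\<close>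
  for \<open>\<theta>\<close> contribute nothing, and leaving them out makes all values, respectively all exponents,
  positive, so that \<open>k\<close> different ones reach \<open>k\<close>.\<close>

primrec max_iterates :: "'u \<Rightarrow> 'u ground_term \<Rightarrow> nat \<Rightarrow> 'u ground_term" where
  "max_iterates u t 0 = C0"
| "max_iterates u t (Suc k) = Maximum ((Ext u ^^ Suc k) t) (max_iterates u t k)"

text \<open>Only two copies of \<open>b\<close> serve all summands. Adding one summand at a time would take a fresh copy
  of \<open>b\<close> for each, and the sum of \<open>n\<close> ones over a \<open>b\<close> of quadratic size would become cubic.\<close>

definition sum_term :: "'u ground_term \<Rightarrow> 'u ground_term list \<Rightarrow> 'u ground_term" where
  "sum_term b ts = Minus b (foldl Minus b ts)"

definition halved :: "nat \<Rightarrow> 'u ground_term \<Rightarrow> 'u ground_term" where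
  "halved j t = ((\<lambda>s. Div s C2) ^^ j) t"

text \<open>If \<open>b\<close> denotes \<open>2\<^sup>K\<close>, then \<open>j \<le> K\<close> halvings leave \<open>2\<^sup>K\<^sup>-\<^sup>j\<close>, and the unknown exponent \<open>K\<close> cancels
  in the quotient.\<close>

definition power_term :: "'u ground_term \<Rightarrow> nat \<Rightarrow> 'u ground_term" where
  "power_term b j = Div b (halved j b)"

lemma eval_iterate: "eval I ((Ext u ^^ i) t) = (I u ^^ i) (eval I t)"
  by (induction i) auto

lemma eval_max_iterates_ge:
  assumes "i \<in> {1..k}"
  shows "(I u ^^ i) (eval I t) \<le> eval I (max_iterates u t k)"
  using assms
proof (induction k)
  case (Suc k)
  show ?case
  proof (cases "i = Suc k")
    case True
    show ?thesis unfolding True max_iterates.simps eval.simps eval_iterate by (rule max.cobounded1)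
  next
    case False
    then have "(I u ^^ i) (eval I t) \<le> eval I (max_iterates u t k)"
      using Suc by auto
    then show ?thesis by (simp add: le_max_iff_disj)
  qed
qed auto

lemma eval_max_iterates_attained:
  "eval I (max_iterates u t k) \<in> insert 0 ((\<lambda>i. (I u ^^ i) (eval I t)) ` {1..k})"
proof (induction k)
  case (Suc k)
  have "eval I (max_iterates u t (Suc k)) = (I u ^^ Suc k) (eval I t)
      \<or> eval I (max_iterates u t (Suc k)) = eval I (max_iterates u t k)"
    unfolding max_iterates.simps eval.simps eval_iterate by (simp add: max_def)
  then show ?case using Suc by (auto intro: rev_image_eqI[of "Suc k"])
qed auto

lemma eval_foldl_Minus: "eval I (foldl Minus b ts) = eval I b - (\<Sum>t\<leftarrow>ts. eval I t)"
  by (induction ts arbitrary: b) auto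

lemma eval_sum_term:
  assumes "(\<Sum>t\<leftarrow>ts. eval I t) \<le> eval I b"
  shows "eval I (sum_term b ts) = (\<Sum>t\<leftarrow>ts. eval I t)"
  using assms by (simp add: sum_term_def eval_foldl_Minus)

lemma eval_halved: "eval I (halved j t) = eval I t div 2 ^ j"
  unfolding halved_def by (induction j) (auto simp flip: div_mult2_eq simp: mult.commute)

lemma eval_power_term:
  assumes "eval I b = 2 ^ K" "j \<le> K"
  shows "eval I (power_term b j) = 2 ^ j"
  using assms by (simp add: power_term_def eval_halved flip: power_diff)

section \<open>Sizes of the constructed terms\<close>

lemma num_function_symbols_le: "num_function_symbols t \<le> num_symbols t"
  by (induction t) auto

lemma num_symbols_iterate: "num_symbols ((Ext u ^^ i) t) = num_symbols t + i"
  by (induction i) auto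

lemma num_symbols_max_iterates:
  assumes "num_symbols t = 1"
  shows "num_symbols (max_iterates u t k) \<le> (k + 1)\<^sup>2"
proof (induction k)
  case (Suc k)
  have "num_symbols (max_iterates u t (Suc k)) = k + 3 + num_symbols (max_iterates u t k)"
    unfolding max_iterates.simps num_symbols.simps num_symbols_iterate using assms by simp
  also have "\<dots> \<le> (Suc k + 1)\<^sup>2"
    using Suc by (simp add: power2_eq_square)
  finally show ?case .
qed auto

lemma num_symbols_foldl_Minus:
  assumes "\<And>t. t \<in> set ts \<Longrightarrow> num_symbols t \<le> c"
  shows "num_symbols (foldl Minus b ts) \<le> num_symbols b + length ts * (c + 1)"
  using assms
proof (induction ts arbitrary: b)
  case (Cons t ts)
  have "num_symbols (foldl Minus b (t # ts)) \<le> num_symbols (Minus b t) + length ts * (c + 1)"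
    unfolding foldl_Cons by (rule Cons.IH) (use Cons.prems in simp)
  also have "\<dots> \<le> num_symbols b + length (t # ts) * (c + 1)"
    using Cons.prems[of t] by simp
  finally show ?case .
qed auto

lemma num_symbols_sum_term:
  assumes "\<And>t. t \<in> set ts \<Longrightarrow> num_symbols t \<le> c"
  shows "num_symbols (sum_term b ts) \<le> 1 + 2 * num_symbols b + length ts * (c + 1)"
  using num_symbols_foldl_Minus[OF assms, of ts b] by (simp add: sum_term_def)

lemma num_symbols_power_term: "num_symbols (power_term b j) = 2 * num_symbols b + 2 * j + 1"
proof -
  have "num_symbols (halved j b) = num_symbols b + 2 * j"
    unfolding halved_def by (induction j) auto
  then show ?thesis by (simp add: power_term_def)
qed

section \<open>The language with \<zeta>\<close>

lemma max_iterates_zeta_ge: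
  assumes "Qstar_axioms \<zeta>"
  shows "k \<le> eval (case_zeta_symbol \<zeta>) (max_iterates Zeta C0 k)"
proof -
  have "inj (\<lambda>i. (\<zeta> ^^ i) 0)"
  proof (rule iterates_inj)
    show "inj \<zeta>"
      using assms by (auto simp: Qstar_axioms_def intro!: injI)
    show "0 \<notin> range \<zeta>"
      using assms by (metis Qstar_axioms_def rangeE)
  qed auto
  then have "inj_on (\<lambda>i. (\<zeta> ^^ i) 0) {1..k}"
    by (rule inj_on_subset) simp
  moreover have "(\<zeta> ^^ i) 0 \<noteq> 0" if "i \<ge> 1" for i
    using assms that by (cases i) (auto simp: Qstar_axioms_def)
  then have "(\<lambda>i. (\<zeta> ^^ i) 0) ` {1..k} \<subseteq> {1..eval (case_zeta_symbol \<zeta>) (max_iterates Zeta C0 k)}"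
    using eval_max_iterates_ge[of _ k "case_zeta_symbol \<zeta>" Zeta C0]
    by (auto simp: Suc_le_eq)
  ultimately show ?thesis by (rule le_of_inj_on_into)
qed

definition unary_term :: "nat \<Rightarrow> Qstar_term" where
  "unary_term n = sum_term (max_iterates Zeta C0 n) (replicate n C1)"

lemma unary_term_represents: "Qstar_represents (unary_term n) n"
  unfolding Qstar_represents_def unary_term_def
  using max_iterates_zeta_ge[of _ n] by (auto simp: eval_sum_term sum_list_replicate)

lemma num_symbols_unary_term: "num_symbols (unary_term n) \<le> 5 * (n + 1)\<^sup>2"
proof -
  have "num_symbols (unary_term n) \<le> 1 + 2 * num_symbols (max_iterates Zeta C0 n) + n * 2"
    using num_symbols_sum_term[of "replicate n C1" 1 "max_iterates Zeta C0 n"]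
    by (auto simp: unary_term_def)
  also have "\<dots> \<le> 1 + 2 * (n + 1)\<^sup>2 + n * 2"
    using num_symbols_max_iterates[of "C0" Zeta n] by simp
  also have "\<dots> \<le> 5 * (n + 1)\<^sup>2"
    by (simp add: power2_eq_square)
  finally show ?thesis .
qed

lemma num_function_symbols_unary_term:
  "(\<lambda>n. real (num_function_symbols (unary_term n))) \<in> O(\<lambda>n. real n ^ 2)"
proof -
  have "real (num_function_symbols (unary_term n)) \<le> 5 * (real n + 1)\<^sup>2" for n
  proof -
    have "real (num_function_symbols (unary_term n)) \<le> real (5 * (n + 1)\<^sup>2)"
      using num_function_symbols_le[of "unary_term n"] num_symbols_unary_term[of n]
      by (simp only: of_nat_le_iff)
    then show ?thesis by (simp add: add.commute)
  qed
  then have "(\<lambda>n. real (num_function_symbols (unary_term n))) \<in> O(\<lambda>n. 5 * (real n + 1)\<^sup>2)"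
    by (intro bigoI[of _ 1] always_eventually) auto
  also have "(\<lambda>n::nat. 5 * (real n + 1)\<^sup>2) \<in> O(\<lambda>n. real n ^ 2)"
    by real_asymp
  finally show ?thesis .
qed

lemma root_nat_le: "root_nat x y \<le> x"
proof (cases "y \<ge> 1 \<and> x \<ge> 1")
  case True
  then have "root y (real x) \<le> root y (real x ^ y)"
    by (intro real_root_le_mono self_le_power) auto
  also have "\<dots> = real x"
    using True by (intro real_root_power_cancel) auto
  finally have "root y (real x) \<le> real x" .
  then have "nat \<lfloor>root y (real x)\<rfloor> \<le> x"
    by linarith
  then show ?thesis by (simp add: root_nat_def)
qed (auto simp: root_nat_def not_le)

lemma bit_less: "bit x i \<Longrightarrow> i < (x :: nat)"
  using less_exp[of x] less_exp[of i] by (cases "i < x")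
    (auto simp: bit_iff_odd not_less div_less order.strict_trans1)

lemma count_bits_le: "count_bits x j \<le> x"
proof -
  have "card {i. i < j \<and> bit x i} \<le> card {..<x}"
    by (intro card_mono) (auto intro: bit_less)
  then show ?thesis by (simp add: count_bits_def)
qed

text \<open>Only the new symbol can exceed the largest of its arguments, and under this interpretation it
  does so by one; the \<open>2\<close> is the largest constant.\<close>

lemma eval_Suc_le: "eval (\<lambda>_. Suc) t \<le> num_function_symbols t + 2"
proof (induction t)
  case (Div s t)
  then show ?case using div_le_dividend[of "eval (\<lambda>_. Suc) s" "eval (\<lambda>_. Suc) t"]
    unfolding eval.simps num_function_symbols.simps by linarith
next
  case (Root s t)
  then show ?case using root_nat_le[of "eval (\<lambda>_. Suc) s" "eval (\<lambda>_. Suc) t"] by simp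
next
  case (Count s t)
  then show ?case using count_bits_le[of "eval (\<lambda>_. Suc) s" "eval (\<lambda>_. Suc) t"] by simp
next
  case (Logarithm t)
  have "floor_log x \<le> x" for x
  proof (cases "x = 0")
    case False
    have "floor_log x < 2 ^ floor_log x" by (rule less_exp)
    also have "\<dots> \<le> x" using False by (intro floor_log_exp2_le) simp
    finally show ?thesis by simp
  qed simp
  from this[of "eval (\<lambda>_. Suc) t"] Logarithm show ?case by simp
qed auto

lemma Qstar_represents_lower_bound:
  assumes "Qstar_represents t n"
  shows "n \<le> num_function_symbols t + 2"
proof -
  have "case_zeta_symbol Suc = (\<lambda>_. Suc)"
    by (auto split: zeta_symbol.splits)
  then have "eval (\<lambda>_. Suc) t = n"
    using assms Qstar_axioms_Suc by (metis Qstar_represents_def)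
  then show ?thesis using eval_Suc_le[of t] by simp
qed

lemma no_polylog_Qstar:
  assumes "\<And>n. Qstar_represents (S n) n"
  shows "(\<lambda>n. real (num_function_symbols (S n))) \<notin> O(\<lambda>n. log 2 (real n) ^ 3)"
proof
  assume "(\<lambda>n. real (num_function_symbols (S n))) \<in> O(\<lambda>n. log 2 (real n) ^ 3)"
  also have "(\<lambda>n. log 2 (real n) ^ 3) \<in> o(\<lambda>n. real n)"
    by real_asymp
  (* Any factor below 1 contradicts n - 2 <= num_function_symbols (S n) for large n;
     with 1/2 this happens as soon as n > 4. *)
  finally have "eventually (\<lambda>n. real (num_function_symbols (S n)) \<le> 1 / 2 * real n) sequentially"
    using landau_o.smallD[of _ _ _ "1 / 2"] by fastforce
  moreover have "eventually (\<lambda>n::nat. n > 4) sequentially"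
    by (rule eventually_gt_at_top)
  ultimately have "eventually (\<lambda>_::nat. False) sequentially"
  proof eventually_elim
    case (elim n)
    have "real n \<le> real (num_function_symbols (S n)) + 2"
      using Qstar_represents_lower_bound[OF assms, of n] by linarith
    then show False using elim by linarith
  qed
  then show False by simp
qed

section \<open>The language with \<theta>\<close>

text \<open>The logarithms of the iterates of \<open>\<theta>\<close> at \<open>1\<close> are pairwise different. That of \<open>1\<close> itself
  is \<open>0\<close>, so the logarithms of the \<open>k\<close> proper iterates are different positive numbers, and the
  largest of them is at least \<open>k\<close>.\<close>

lemma max_iterates_theta:
  assumes "Q_axioms \<theta>" "k \<ge> 1"
  obtains K where "k \<le> K" "eval (case_theta_symbol \<theta>) (max_iterates Theta C1 k) = 2 ^ K"
proof -
  let ?f = "\<lambda>i. (\<theta> ^^ i) 1"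
  let ?M = "eval (case_theta_symbol \<theta>) (max_iterates Theta C1 k)"
  have Power_1: "Power 1"
    by (simp add: Power_def)
  have "inj ?f"
  proof (rule iterates_inj)
    show "inj_on \<theta> {x. Power x}"
      using assms(1) unfolding Q_axioms_def inj_on_def by blast
    show "\<theta> ` {x. Power x} \<subseteq> {x. Power x}" "1 \<notin> \<theta> ` {x. Power x}"
      using assms(1) by (auto simp: Q_axioms_def dest: sym)
  qed (use Power_1 in simp)
  have "Power (?f i)" for i
    using assms(1) Power_1 by (induction i) (auto simp: Q_axioms_def)
  then obtain e where e: "?f i = 2 ^ e i" for i
    unfolding Power_iff by metis
  have ge: "?f i \<le> ?M" if "i \<in> {1..k}" for i
    using eval_max_iterates_ge[OF that, of "case_theta_symbol \<theta>" Theta C1] by simp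
  have "0 < ?M"
    using ge[of 1] e[of 1] assms(2) less_le_trans[of 0 "2 ^ e 1" ?M] by simp
  then obtain i where i: "?M = 2 ^ e i"
    using eval_max_iterates_attained[of "case_theta_symbol \<theta>" Theta C1 k] e by auto
  have "inj e"
    using \<open>inj ?f\<close> e by (metis (no_types, lifting) injD injI)
  then have "inj_on e {1..k}"
    by (rule inj_on_subset) simp
  moreover have "e j \<in> {1..e i}" if "j \<in> {1..k}" for j
  proof -
    have "e j \<le> e i"
      using ge[OF that] unfolding e i by simp
    moreover have "e j \<noteq> e 0"
      using \<open>inj e\<close> that by (auto dest: injD)
    moreover have "e 0 = 0"
      using e[of 0] by (cases "e 0") auto
    ultimately show ?thesis by simp
  qed
  then have "e ` {1..k} \<subseteq> {1..e i}" by blast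
  ultimately have "k \<le> e i" by (rule le_of_inj_on_into)
  then show ?thesis using i that by blast
qed

lemma sum_binary_digits:
  fixes n :: nat
  assumes "n < 2 ^ k"
  shows "(\<Sum>j\<leftarrow>[0..<k]. if bit n j then 2 ^ j else 0) = n"
proof -
  have "(\<Sum>j\<leftarrow>[0..<k]. if bit n j then 2 ^ j else 0 :: nat)
      = (\<Sum>j = 0..<k. push_bit j (of_bool (bit n j)))"
    unfolding interv_sum_list_conv_sum_set_nat by (intro sum.cong) (auto simp: push_bit_eq_mult)
  also have "\<dots> = take_bit k n"
    by (rule take_bit_sum [symmetric])
  finally show ?thesis using assms by (simp add: take_bit_nat_eq_self)
qed

text \<open>The case \<open>n = 0\<close> is counted as one digit here, which keeps \<open>k\<close> positive: the maximum of no
  iterates would be \<open>0\<close>, which is not a power of two.\<close>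

definition binary_term :: "nat \<Rightarrow> Q_term" where
  "binary_term n = (let k = Suc (floor_log n); b = max_iterates Theta C1 k in
     sum_term b (map (\<lambda>j. if bit n j then power_term b j else C0) [0..<k]))"

lemma binary_term_represents: "Q_represents (binary_term n) n"
  unfolding Q_represents_def
proof (intro allI impI)
  fix \<theta> assume \<theta>: "Q_axioms \<theta>"
  let ?I = "case_theta_symbol \<theta>"
  define k where "k = Suc (floor_log n)"
  define b where "b = max_iterates Theta C1 k"
  define ts where "ts = map (\<lambda>j. if bit n j then power_term b j else C0) [0..<k]"
  obtain K where K: "k \<le> K" "eval ?I b = 2 ^ K"
    using max_iterates_theta[OF \<theta>, of k] by (auto simp: k_def b_def)
  have n_less: "n < 2 ^ k"
    using floor_log_exp2_gt[of n] by (simp add: k_def)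
  have "(\<Sum>t\<leftarrow>ts. eval ?I t) = (\<Sum>j\<leftarrow>[0..<k]. if bit n j then 2 ^ j else 0)"
    unfolding ts_def map_map o_def
    by (intro arg_cong[of _ _ sum_list] map_cong) (use K in \<open>auto simp: eval_power_term\<close>)
  also have "\<dots> = n"
    using n_less by (rule sum_binary_digits)
  finally have sum: "(\<Sum>t\<leftarrow>ts. eval ?I t) = n" .
  have "n \<le> eval ?I b"
    using n_less power_increasing[OF K(1), of "2 :: nat"] K(2) by linarith
  then have "eval ?I (sum_term b ts) = n"
    using sum by (simp add: eval_sum_term)
  then show "eval ?I (binary_term n) = n"
    unfolding binary_term_def Let_def ts_def b_def k_def .
qed

text \<open>With \<open>k\<close> digits, the bound \<open>b\<close> has at most \<open>(k + 1)\<^sup>2\<close> symbols; the dominant part of the term is \<open>k\<close>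
  summands with two copies of \<open>b\<close> each.\<close>

lemma num_symbols_binary_term: "num_symbols (binary_term n) \<le> 4 * (floor_log n + 2) ^ 3"
proof -
  define k where "k = Suc (floor_log n)"
  define b where "b = max_iterates Theta C1 k"
  define ts where "ts = map (\<lambda>j. if bit n j then power_term b j else C0) [0..<k]"
  have b: "num_symbols b \<le> (k + 1)\<^sup>2"
    unfolding b_def by (rule num_symbols_max_iterates) simp
  have "num_symbols t \<le> 2 * (k + 1)\<^sup>2 + 2 * k + 1" if "t \<in> set ts" for t
    using that b by (auto simp: ts_def num_symbols_power_term)
  then have "num_symbols (sum_term b ts)
      \<le> 1 + 2 * num_symbols b + length ts * (2 * (k + 1)\<^sup>2 + 2 * k + 1 + 1)"
    by (rule num_symbols_sum_term)
  also have "\<dots> \<le> 1 + 2 * (k + 1)\<^sup>2 + k * (2 * (k + 1)\<^sup>2 + 2 * k + 1 + 1)"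
    using b by (simp add: ts_def)
  also have "\<dots> \<le> 4 * (k + 1) ^ 3"
    by (simp add: power2_eq_square power3_eq_cube algebra_simps)
  finally show ?thesis
    unfolding binary_term_def Let_def ts_def b_def k_def by simp
qed

lemma num_symbols_binary_term_bigo:
  "(\<lambda>n. real (num_symbols (binary_term n))) \<in> O(\<lambda>n. log 2 (real n) ^ 3)"
proof -
  have "eventually (\<lambda>n. norm (real (num_symbols (binary_term n))) \<le> 1 * norm (4 * (log 2 (real n) + 2) ^ 3))
      sequentially"
    using eventually_ge_at_top[of 1]
  proof eventually_elim
    case (elim n)
    have "real (2 ^ floor_log n) \<le> real n"
      using elim floor_log_exp2_le[of n] by (simp only: of_nat_le_iff)
    then have "real (floor_log n) \<le> log 2 (real n)"
      using elim by (intro le_log_of_power) auto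
    then have "4 * (real (floor_log n) + 2) ^ 3 \<le> 4 * (log 2 (real n) + 2) ^ 3"
      by (intro mult_left_mono power_mono) auto
    moreover have "real (num_symbols (binary_term n)) \<le> real (4 * (floor_log n + 2) ^ 3)"
      using num_symbols_binary_term[of n] by (simp only: of_nat_le_iff)
    ultimately show ?case by (simp add: add.commute)
  qed
  then have "(\<lambda>n. real (num_symbols (binary_term n))) \<in> O(\<lambda>n. 4 * (log 2 (real n) + 2) ^ 3)"
    by (rule bigoI)
  also have "(\<lambda>n::nat. 4 * (log 2 (real n) + 2) ^ 3) \<in> O(\<lambda>n. log 2 (real n) ^ 3)"
    by real_asymp
  finally show ?thesis .
qed

section \<open>Comparison of the two languages\<close>

theorem proposition4p3:
  shows "(\<exists>Tstar. (\<forall>n. Qstar_represents (Tstar n) n) \<and>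
            (\<lambda>n. real (num_function_symbols (Tstar n))) \<in> O(\<lambda>n. real n ^ 2))
       \<and> (\<nexists>Tstar. (\<forall>n. Qstar_represents (Tstar n) n) \<and>
            (\<lambda>n. real (num_function_symbols (Tstar n))) \<in> O(\<lambda>n. log 2 (real n) ^ 3))
       \<and> (\<exists>T. (\<forall>n. Q_represents (T n) n) \<and>
            (\<lambda>n. real (num_symbols (T n))) \<in> O(\<lambda>n. log 2 (real n) ^ 3))"
  using unary_term_represents num_function_symbols_unary_term no_polylog_Qstar
    binary_term_represents num_symbols_binary_term_bigo
  by blast

end
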